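(* Let $d\ge 1$, $\varepsilon>0$, $\Delta t>0$, $\Omega=[-1,1]^d$, $s\ge 1$, and let $(a_{ij})_{1\le i,j\le s}$ be a real lower triangular matrix with $a_{ii}\ge 0$ for all $i$ and at least one nonzero diagonal entry, and $b_1,\dots,b_s\in\mathbb{R}$. Put $F(\phi)=\Delta\phi-\frac{1}{\varepsilon^2}(\phi^3-\phi)$. If $$\Delta t\le \frac{\varepsilon^2}{\max_{i} a_{ii}},$$ then the diagonally implicit Runge-Kutta (DIRK) method with these coefficients for the Allen-Cahn equation is stable: given a smooth $\phi^n:\Omega\to\mathbb{R}$ with $\frac{\partial\phi^n}{\partial\mathbf{n}}=0$ on $\partial\Omega$, for each $i=1,\dots,s$ and given the previous stages $\phi^{n+1}_0=\phi^n,\phi^{n+1}_1,\dots,\phi^{n+1}_{i-1}$, there is at most one smooth $\phi^{n+1}_i:\Omega\to\mathbb{R}$ satisfying $$\phi^{n+1}_i=\phi^{n+1}_0+\Delta t\sum_{j=1}^{i}a_{ij}F(\phi^{n+1}_j)\ \text{ in }\Omega,\qquad \frac{\partial\phi^{n+1}_i}{\partial\mathbf{n}}=0\ \text{ on }\partial\Omega;$$ consequently $\phi^{n+1}=\phi^{n+1}_0+\Delta t\sum_{i=1}^s b_iF(\phi^{n+1}_i)$ is unique given $\phi^n$.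
   Context: The Allen-Cahn equation is $\phi_t-\Delta\phi+\frac{1}{\varepsilon^2}(\phi^3-\phi)=0$ on $\Omega=[-1,1]^d$ with homogeneous Neumann boundary conditions. $\Delta$ applied to a function is the Laplacian in $x=(x_1,\dots,x_d)$; $\Delta t$ is a single symbol, the time step size. $\mathbf{n}$ is the unit outward normal; on the cube the condition $\frac{\partial\phi}{\partial\mathbf{n}}=0$ means $\partial_{x_i}\phi=0$ on each face $x_i=\pm1$. "Smooth" means $C^\infty$ up to the boundary. The DIRK method computes the stages $\phi^{n+1}_1,\dots,\phi^{n+1}_s$ one after another and then $\phi^{n+1}$ by the formulas in the claim. The method is called stable if $\phi^{n+1}$ is unique given $\phi^n$. *)

theory Defs
  imports "HOL-Analysis.Analysis"
begin

text \<open>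
  Functions on the closed cube are total functions of which only the values on the cube matter:
  equations are imposed, and uniqueness is asserted, pointwise on the cube.
\<close>

definition cube :: "(real ^ 'd) set" where
  "cube = cbox (\<chi> i. - 1) (\<chi> i. 1)"

text \<open>
  Derivatives are taken within the closed cube, hence are one-sided at the faces. They are unique
  there, since the cube is convex with nonempty interior.
\<close>

definition partial :: "'d \<Rightarrow> (real ^ 'd \<Rightarrow> real) \<Rightarrow> real ^ 'd \<Rightarrow> real" where
  "partial i f x = frechet_derivative f (at x within cube) (axis i 1)"

text \<open>
  Smoothness up to the boundary: all iterated partial derivatives are (one-sidedly) differentiable,
  hence also continuous, on the whole closed cube.
\<close>

definition smooth_on_cube :: "(real ^ 'd \<Rightarrow> real) \<Rightarrow> bool" where
  "smooth_on_cube f \<longleftrightarrow> (\<forall>is. foldr partial is f differentiable_on cube)"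

definition laplacian :: "(real ^ 'd \<Rightarrow> real) \<Rightarrow> real ^ 'd \<Rightarrow> real" where
  "laplacian f x = (\<Sum>i\<in>UNIV. partial i (partial i f) x)"

text \<open>
  The outward normal on the face \<open>x $ i = \<plusminus>1\<close> is \<open>\<plusminus> axis i 1\<close>. At edges and corners the condition is
  imposed for every face containing the point.
\<close>

definition neumann :: "(real ^ 'd \<Rightarrow> real) \<Rightarrow> bool" where
  "neumann f \<longleftrightarrow> (\<forall>x\<in>cube. \<forall>i. x $ i = - 1 \<or> x $ i = 1 \<longrightarrow> partial i f x = 0)"

definition allen_cahn_rhs :: "real \<Rightarrow> (real ^ 'd \<Rightarrow> real) \<Rightarrow> real ^ 'd \<Rightarrow> real" where
  "allen_cahn_rhs \<epsilon> f x = laplacian f x - 1 / \<epsilon>\<^sup>2 * ((f x) ^ 3 - f x)"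

text \<open>
  \<open>\<Phi> 0\<close> is the old time level and \<open>\<Phi> 1, \<dots>, \<Phi> s\<close> are the stages; the coefficients \<open>A i j\<close> and
  \<open>b i\<close> are indexed from 1, values at other indices being irrelevant.
\<close>

definition dirk_stage ::
  "real \<Rightarrow> real \<Rightarrow> (nat \<Rightarrow> nat \<Rightarrow> real) \<Rightarrow> (nat \<Rightarrow> real ^ 'd \<Rightarrow> real) \<Rightarrow> nat \<Rightarrow> bool" where
  "dirk_stage \<epsilon> dt A \<Phi> i \<longleftrightarrow>
     smooth_on_cube (\<Phi> i) \<and> neumann (\<Phi> i) \<and>
     (\<forall>x\<in>cube. \<Phi> i x = \<Phi> 0 x + dt * (\<Sum>j=1..i. A i j * allen_cahn_rhs \<epsilon> (\<Phi> j) x))"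

definition dirk_step ::
  "real \<Rightarrow> real \<Rightarrow> nat \<Rightarrow> (nat \<Rightarrow> nat \<Rightarrow> real) \<Rightarrow> (nat \<Rightarrow> real) \<Rightarrow>
     (real ^ 'd \<Rightarrow> real) \<Rightarrow> (real ^ 'd \<Rightarrow> real) \<Rightarrow> bool" where
  "dirk_step \<epsilon> dt s A b f g \<longleftrightarrow>
     (\<exists>\<Phi>. \<Phi> 0 = f \<and> (\<forall>i\<in>{1..s}. dirk_stage \<epsilon> dt A \<Phi> i) \<and>
       (\<forall>x\<in>cube. g x = \<Phi> 0 x + dt * (\<Sum>i=1..s. b i * allen_cahn_rhs \<epsilon> (\<Phi> i) x)))"

text \<open>The \<open>itself\<close> argument carries the space dimension \<open>CARD('d)\<close>.\<close>

definition dirk_stable ::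
  "'d::finite itself \<Rightarrow> real \<Rightarrow> real \<Rightarrow> nat \<Rightarrow> (nat \<Rightarrow> nat \<Rightarrow> real) \<Rightarrow> (nat \<Rightarrow> real) \<Rightarrow> bool" where
  "dirk_stable _ \<epsilon> dt s A b \<longleftrightarrow>
     (\<forall>(f :: real ^ 'd \<Rightarrow> real) g h.
        smooth_on_cube f \<and> neumann f \<and> dirk_step \<epsilon> dt s A b f g \<and> dirk_step \<epsilon> dt s A b f h
        \<longrightarrow> (\<forall>x\<in>cube. g x = h x))"

end

theory Submission
  imports Defs
begin

text \<open>
  Two candidates \<open>u\<close>, \<open>v\<close> for the same stage satisfy, with \<open>c = dt * A i i\<close>,
  \<open>u - v = c * (\<Delta>u - \<Delta>v - (u\<^sup>3 - v\<^sup>3 - (u - v)) / \<epsilon>\<^sup>2)\<close>, that is,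
  \<open>(1 - c / \<epsilon>\<^sup>2) * (u - v) + c / \<epsilon>\<^sup>2 * (u\<^sup>3 - v\<^sup>3) = c * (\<Delta>u - \<Delta>v)\<close>. Since \<open>A i i\<close> is
  nonnegative and the step size restricted, \<open>0 \<le> c / \<epsilon>\<^sup>2 \<le> 1\<close>, so the left-hand side is positive wherever \<open>u > v\<close>. On the other hand, at a
  maximum point of \<open>u - v\<close> over the cube the right-hand side is nonpositive
  (\<open>laplacian_le_at_max_diff\<close>): in each coordinate direction the first derivative vanishes at the
  maximum, by Fermat in the interior and by the Neumann condition on the faces, and so the second
  derivative cannot be positive, not even a one-sided one. Hence \<open>u \<le> v\<close> (\<open>implicit_stage_le\<close>),
  and by symmetry \<open>u = v\<close> (\<open>dirk_stage_unique\<close>). Such a maximum principle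
  takes the place of the energy argument of testing the equation with \<open>u - v\<close>, and needs no integration by parts.

  Uniqueness of the whole step follows by induction on the stages, since \<open>F(\<phi>)\<close> on the cube
  depends only on the values of \<open>\<phi>\<close> on the cube (\<open>allen_cahn_rhs_cong\<close>).
\<close>

section \<open>The maximum principle on the cube\<close>

text \<open>
  The maximum may sit at an endpoint, where \<open>D\<close> is a one-sided derivative: \<open>D > 0\<close> would make
  \<open>g'\<close> positive just to the right of \<open>t0\<close> or negative just to the left, so that \<open>g\<close> would exceed
  \<open>g t0\<close> there.
\<close>

lemma second_deriv_nonpos_at_max:
  fixes g g' :: "real \<Rightarrow> real"
  assumes "a < b" and t0: "t0 \<in> {a..b}"
    and g: "\<And>t. t \<in> {a..b} \<Longrightarrow> (g has_real_derivative g' t) (at t within {a..b})"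
    and g': "(g' has_real_derivative D) (at t0 within {a..b})"
    and max: "\<And>t. t \<in> {a..b} \<Longrightarrow> g t \<le> g t0"
    and endpoints: "t0 = a \<or> t0 = b \<Longrightarrow> g' t0 = 0"
  shows "D \<le> 0"
proof (rule ccontr)
  assume "\<not> D \<le> 0"
  then have D: "D > 0" by simp
  have crit: "g' t0 = 0"
  proof (cases "t0 = a \<or> t0 = b")
    case False
    with t0 have "t0 \<in> {a<..<b}" by auto
    then have "(g has_real_derivative g' t0) (at t0)"
      using g[OF t0] by (metis at_within_Icc_at greaterThanLessThan_iff)
    moreover have "0 < min (t0 - a) (b - t0)" using \<open>t0 \<in> {a<..<b}\<close> by auto
    ultimately show ?thesis
      by (rule DERIV_local_max) (use max in \<open>auto simp: abs_if split: if_splits\<close>)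
  qed (use endpoints in auto)
  have cont: "continuous_on {a..b} g"
    by (rule DERIV_continuous_on) (rule g)
  have mvt: "\<exists>z. x < z \<and> z < y \<and> g y - g x = (y - x) * g' z"
    if "a \<le> x" "x < y" "y \<le> b" for x y
  proof -
    have "(g has_derivative (*) (g' z)) (at z)" if "x < z" "z < y" for z
      using g[of z] that \<open>a \<le> x\<close> \<open>y \<le> b\<close> at_within_Icc_at[of a z b]
      by (simp add: has_field_derivative_def)
    moreover have "continuous_on {x..y} g"
      by (rule continuous_on_subset[OF cont]) (use that in auto)
    ultimately obtain z where "x < z" "z < y" "g y - g x = g' z * (y - x)"
      using mvt[OF \<open>x < y\<close>, of g "\<lambda>z. (*) (g' z)"] by auto
    then show ?thesis by (auto simp: mult.commute)
  qed
  \<comment> \<open>Move a small distance away from \<open>t0\<close>, to a side on which the interval continues.\<close>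
  show False
  proof (cases "t0 < b")
    case True
    obtain d where d: "d > 0" "\<And>h. h > 0 \<Longrightarrow> t0 + h \<in> {a..b} \<Longrightarrow> h < d \<Longrightarrow> g' t0 < g' (t0 + h)"
      using has_real_derivative_pos_inc_right[OF g' D] by blast
    define y where "y = t0 + min (d / 2) (b - t0)"
    have y: "t0 < y" "y \<le> b" "y < t0 + d" using d(1) True by (auto simp: y_def)
    obtain z where z: "t0 < z" "z < y" "g y - g t0 = (y - t0) * g' z"
      using mvt[of t0 y] t0 y by auto
    have "g' z > 0" using d(2)[of "z - t0"] z y t0 crit by auto
    then have "g y > g t0" using z y by (metis diff_gt_0_iff_gt mult_pos_pos)
    with max[of y] y t0 show False by auto
  next
    case False
    with t0 \<open>a < b\<close> have "a < t0" by auto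
    obtain d where d: "d > 0" "\<And>h. h > 0 \<Longrightarrow> t0 - h \<in> {a..b} \<Longrightarrow> h < d \<Longrightarrow> g' (t0 - h) < g' t0"
      using has_real_derivative_pos_inc_left[OF g' D] by blast
    define y where "y = t0 - min (d / 2) (t0 - a)"
    have y: "y < t0" "a \<le> y" "t0 - d < y" using d(1) \<open>a < t0\<close> by (auto simp: y_def)
    obtain z where z: "y < z" "z < t0" "g t0 - g y = (t0 - y) * g' z"
      using mvt[of y t0] t0 y by auto
    have "g' z < 0" using d(2)[of "t0 - z"] z y t0 crit by auto
    then have "g t0 - g y < 0" using z y by (simp add: mult_pos_neg)
    with max[of y] y t0 show False by auto
  qed
qed

lemma mem_cube_iff: "x \<in> cube \<longleftrightarrow> (\<forall>i. - 1 \<le> x $ i \<and> x $ i \<le> 1)"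
  by (simp add: cube_def mem_box_cart)

lemma partial_has_real_derivative:
  fixes f :: "real ^ 'd \<Rightarrow> real"
  assumes f: "f differentiable_on cube" and x: "x \<in> cube" and t: "t \<in> {- 1..1}"
  shows "((\<lambda>t. f (x + (t - x $ i) *\<^sub>R axis i 1)) has_real_derivative
            partial i f (x + (t - x $ i) *\<^sub>R axis i 1)) (at t within {- 1..1})"
proof -
  define p where "p = (\<lambda>t. x + (t - x $ i) *\<^sub>R axis i (1::real))"
  have p_cube: "p t \<in> cube" if "t \<in> {- 1..1}" for t
    using x that by (auto simp: mem_cube_iff p_def axis_def)
  have p: "(p has_derivative (\<lambda>h. h *\<^sub>R axis i 1)) (at t within {- 1..1})"
    unfolding p_def by (auto intro!: derivative_eq_intros)
  define f' where "f' = frechet_derivative f (at (p t) within cube)"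
  have f': "(f has_derivative f') (at (p t) within cube)"
    using f p_cube[OF t] unfolding f'_def differentiable_on_def
    by (simp add: frechet_derivative_works)
  then have "linear f'" by (rule has_derivative_linear)
  have "(f has_derivative f') (at (p t) within p ` {- 1..1})"
    using f' by (rule has_derivative_subset) (use p_cube in auto)
  from has_derivative_in_compose[OF p this]
  have "((\<lambda>t. f (p t)) has_derivative (\<lambda>h. f' (h *\<^sub>R axis i 1))) (at t within {- 1..1})" .
  moreover have "(\<lambda>h. f' (h *\<^sub>R axis i 1)) = (*) (f' (axis i 1))"
    using \<open>linear f'\<close> by (auto simp: linear_scale)
  ultimately show ?thesis
    by (simp add: has_field_derivative_def p_def f'_def partial_def)
qed

lemma smooth_on_cube_differentiable:
  assumes "smooth_on_cube f"
  shows "f differentiable_on cube" and "partial i f differentiable_on cube"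
proof -
  have "foldr partial is f differentiable_on cube" for "is"
    using assms by (simp add: smooth_on_cube_def)
  from this[of "[]"] this[of "[i]"]
  show "f differentiable_on cube" "partial i f differentiable_on cube" by simp_all
qed

text \<open>
  The Laplacian part of the maximum principle: on the closed cube the Neumann condition makes it
  hold at boundary points too.
\<close>

lemma laplacian_le_at_max_diff:
  fixes u v :: "real ^ 'd::finite \<Rightarrow> real"
  assumes u: "smooth_on_cube u" "neumann u" and v: "smooth_on_cube v" "neumann v"
    and x: "x \<in> cube" and max: "\<And>y. y \<in> cube \<Longrightarrow> u y - v y \<le> u x - v x"
  shows "laplacian u x \<le> laplacian v x"
  unfolding laplacian_def
proof (rule sum_mono)
  fix i :: 'd
  define p where "p = (\<lambda>t. x + (t - x $ i) *\<^sub>R axis i (1::real))"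
  have p_cube: "p t \<in> cube" if "t \<in> {- 1..1}" for t
    using x that by (auto simp: mem_cube_iff p_def axis_def)
  have px: "p (x $ i) = x" by (simp add: p_def)
  have t0: "x $ i \<in> {- 1..1}" using x by (auto simp: mem_cube_iff)
  have deriv: "((\<lambda>t. f (p t)) has_real_derivative partial i f (p t)) (at t within {- 1..1})"
    if "f differentiable_on cube" "t \<in> {- 1..1}" for f t
    using partial_has_real_derivative[OF that(1) x that(2), of i] by (simp add: p_def)
  have "partial i (partial i u) (p (x $ i)) - partial i (partial i v) (p (x $ i)) \<le> 0"
  proof (rule second_deriv_nonpos_at_max[OF _ t0])
    show "((\<lambda>t. u (p t) - v (p t)) has_real_derivative partial i u (p t) - partial i v (p t))
            (at t within {- 1..1})" if "t \<in> {- 1..1}" for t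
      by (intro DERIV_diff deriv smooth_on_cube_differentiable u v that)
    show "((\<lambda>t. partial i u (p t) - partial i v (p t)) has_real_derivative
            partial i (partial i u) (p (x $ i)) - partial i (partial i v) (p (x $ i)))
            (at (x $ i) within {- 1..1})"
      by (intro DERIV_diff deriv smooth_on_cube_differentiable u v t0)
    show "u (p t) - v (p t) \<le> u (p (x $ i)) - v (p (x $ i))" if "t \<in> {- 1..1}" for t
      using max[OF p_cube[OF that]] by (simp add: px)
    show "partial i u (p (x $ i)) - partial i v (p (x $ i)) = 0" if "x $ i = - 1 \<or> x $ i = 1"
      using that u v x by (auto simp: px neumann_def)
  qed simp
  then show "partial i (partial i u) x \<le> partial i (partial i v) x" by (simp add: px)
qed

text \<open>
  Comparison for the implicit equation \<open>u - c * F(u) = v - c * F(v)\<close>; the bound \<open>c \<le> \<epsilon>\<^sup>2\<close> makes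
  \<open>r \<mapsto> r + c / \<epsilon>\<^sup>2 * (r\<^sup>3 - r)\<close> strictly increasing.
\<close>

lemma implicit_stage_le:
  fixes u v :: "real ^ 'd::finite \<Rightarrow> real"
  assumes "\<epsilon> > 0" and c: "0 \<le> c" "c \<le> \<epsilon>\<^sup>2"
    and u: "smooth_on_cube u" "neumann u" and v: "smooth_on_cube v" "neumann v"
    and eq: "\<And>x. x \<in> cube \<Longrightarrow> u x - v x = c * (allen_cahn_rhs \<epsilon> u x - allen_cahn_rhs \<epsilon> v x)"
    and y: "y \<in> cube"
  shows "u y \<le> v y"
proof -
  have "continuous_on cube (\<lambda>x. u x - v x)"
    by (intro continuous_on_diff differentiable_imp_continuous_on smooth_on_cube_differentiable u v)
  moreover have "compact (cube :: (real ^ 'd) set)" by (simp add: cube_def)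
  ultimately obtain x where x: "x \<in> cube" and max: "\<And>y. y \<in> cube \<Longrightarrow> u y - v y \<le> u x - v x"
    using continuous_attains_sup[of cube "\<lambda>x. u x - v x"] y by blast
  have "u x \<le> v x"
  proof (rule ccontr)
    assume "\<not> u x \<le> v x"
    then have w: "u x - v x > 0" by simp
    then have "(v x) ^ 3 \<le> (u x) ^ 3" by (intro power_mono_odd) auto
    moreover have "(v x) ^ 3 \<noteq> (u x) ^ 3"
      using w odd_real_root_power_cancel[of 3 "u x"] odd_real_root_power_cancel[of 3 "v x"] by force
    ultimately have cubes: "(u x) ^ 3 - (v x) ^ 3 > 0" by simp
    define k where "k = c / \<epsilon>\<^sup>2"
    have k: "0 \<le> k" "k \<le> 1" using c \<open>\<epsilon> > 0\<close> by (auto simp: k_def field_simps)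
    have "u x - v x = c * (laplacian u x - laplacian v x)
            - k * ((u x) ^ 3 - (v x) ^ 3) + k * (u x - v x)"
      by (rule trans[OF eq[OF x]]) (simp add: allen_cahn_rhs_def k_def algebra_simps diff_divide_distrib)
    then have "(1 - k) * (u x - v x) + k * ((u x) ^ 3 - (v x) ^ 3)
                 = c * (laplacian u x - laplacian v x)"
      by (simp add: algebra_simps)
    also have "\<dots> \<le> 0"
      using laplacian_le_at_max_diff[OF u v x max] c by (simp add: mult_nonneg_nonpos)
    finally have "(1 - k) * (u x - v x) + k * ((u x) ^ 3 - (v x) ^ 3) \<le> 0" .
    moreover have "(1 - k) * (u x - v x) + k * ((u x) ^ 3 - (v x) ^ 3) > 0"
    proof (cases "k = 1")
      case True
      then show ?thesis using cubes by simp
    next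
      case False
      then have "(1 - k) * (u x - v x) > 0" using k w by simp
      moreover have "k * ((u x) ^ 3 - (v x) ^ 3) \<ge> 0" using k cubes by simp
      ultimately show ?thesis by linarith
    qed
    ultimately show False by simp
  qed
  with max[OF y] show ?thesis by linarith
qed

section \<open>Uniqueness of the stages and of the step\<close>

lemma partial_cong:
  assumes "\<And>x. x \<in> cube \<Longrightarrow> f x = g x" and "x \<in> cube"
  shows "partial i f x = partial i g x"
proof -
  have "(f has_derivative D) (at x within cube) \<longleftrightarrow> (g has_derivative D) (at x within cube)" for D
    using has_derivative_transform[of x cube g f D] has_derivative_transform[of x cube f g D] assms
    by auto
  then show ?thesis by (simp add: partial_def frechet_derivative_def)
qed

lemma allen_cahn_rhs_cong:
  fixes f g :: "real ^ 'd::finite \<Rightarrow> real"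
  assumes eq: "\<And>x. x \<in> cube \<Longrightarrow> f x = g x" and x: "x \<in> cube"
  shows "allen_cahn_rhs \<epsilon> f x = allen_cahn_rhs \<epsilon> g x"
proof -
  have "partial i (partial i f) x = partial i (partial i g) x" for i
    using x by (intro partial_cong eq)
  then show ?thesis by (simp add: allen_cahn_rhs_def laplacian_def eq[OF x])
qed

lemma dirk_stage_unique:
  fixes \<Phi> \<Psi> :: "nat \<Rightarrow> real ^ 'd::finite \<Rightarrow> real"
  assumes "\<epsilon> > 0" and c: "0 \<le> dt * A i i" "dt * A i i \<le> \<epsilon>\<^sup>2" and "1 \<le> i"
    and \<Phi>: "dirk_stage \<epsilon> dt A \<Phi> i" and \<Psi>: "dirk_stage \<epsilon> dt A \<Psi> i"
    and prev: "\<And>j x. j < i \<Longrightarrow> x \<in> cube \<Longrightarrow> \<Phi> j x = \<Psi> j x"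
    and y: "y \<in> cube"
  shows "\<Phi> i y = \<Psi> i y"
proof -
  have eq: "\<Phi> i x - \<Psi> i x
              = dt * A i i * (allen_cahn_rhs \<epsilon> (\<Phi> i) x - allen_cahn_rhs \<epsilon> (\<Psi> i) x)"
    if x: "x \<in> cube" for x
  proof -
    have split: "(\<Sum>j=1..i. h j) = (\<Sum>j\<in>{1..<i}. h j) + h i" for h :: "nat \<Rightarrow> real"
      using \<open>1 \<le> i\<close> by (simp add: atLeastLessThanSuc_atLeastAtMost[symmetric])
    have earlier: "(\<Sum>j\<in>{1..<i}. A i j * allen_cahn_rhs \<epsilon> (\<Phi> j) x)
            = (\<Sum>j\<in>{1..<i}. A i j * allen_cahn_rhs \<epsilon> (\<Psi> j) x)"
    proof (rule sum.cong[OF refl])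
      fix j assume "j \<in> {1..<i}"
      then show "A i j * allen_cahn_rhs \<epsilon> (\<Phi> j) x = A i j * allen_cahn_rhs \<epsilon> (\<Psi> j) x"
        using allen_cahn_rhs_cong[of "\<Phi> j" "\<Psi> j" x \<epsilon>] prev x by auto
    qed
    have "\<Phi> i x = \<Phi> 0 x + dt * (\<Sum>j=1..i. A i j * allen_cahn_rhs \<epsilon> (\<Phi> j) x)"
      and "\<Psi> i x = \<Psi> 0 x + dt * (\<Sum>j=1..i. A i j * allen_cahn_rhs \<epsilon> (\<Psi> j) x)"
      using \<Phi> \<Psi> x by (auto simp: dirk_stage_def)
    moreover have "\<Phi> 0 x = \<Psi> 0 x" using prev x \<open>1 \<le> i\<close> by auto
    ultimately show ?thesis unfolding split earlier by (simp add: algebra_simps)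
  qed
  have smooth: "smooth_on_cube (\<Phi> i)" "neumann (\<Phi> i)" "smooth_on_cube (\<Psi> i)" "neumann (\<Psi> i)"
    using \<Phi> \<Psi> by (auto simp: dirk_stage_def)
  have "\<Phi> i y \<le> \<Psi> i y"
    by (rule implicit_stage_le[OF \<open>\<epsilon> > 0\<close> c smooth(1-4) eq y])
  moreover have "\<Psi> i y \<le> \<Phi> i y"
  proof (rule implicit_stage_le[OF \<open>\<epsilon> > 0\<close> c smooth(3,4,1,2) _ y])
    show "\<Psi> i x - \<Phi> i x = dt * A i i * (allen_cahn_rhs \<epsilon> (\<Psi> i) x - allen_cahn_rhs \<epsilon> (\<Phi> i) x)"
      if "x \<in> cube" for x
      using eq[OF that] by (simp add: algebra_simps)
  qed
  ultimately show ?thesis by simp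
qed

theorem mainTheorem4:
  fixes \<epsilon> dt :: real and s :: nat
    and A :: "nat \<Rightarrow> nat \<Rightarrow> real" and b :: "nat \<Rightarrow> real"
  assumes "\<epsilon> > 0" and "dt > 0" and "s \<ge> 1"
    and lower_triangular: "\<forall>i\<in>{1..s}. \<forall>j\<in>{1..s}. i < j \<longrightarrow> A i j = 0"
    and diagonal_nonneg: "\<forall>i\<in>{1..s}. A i i \<ge> 0"
    and diagonal_nonzero: "\<exists>i\<in>{1..s}. A i i \<noteq> 0"
    and step_size: "dt \<le> \<epsilon>\<^sup>2 / Max ((\<lambda>i. A i i) ` {1..s})"
  shows "(\<forall>\<phi> :: real ^ 'd::finite \<Rightarrow> real. smooth_on_cube \<phi> \<and> neumann \<phi> \<longrightarrow>
            (\<forall>i\<in>{1..s}. \<forall>\<Phi>. \<Phi> 0 = \<phi> \<and> (\<forall>j\<in>{1..<i}. dirk_stage \<epsilon> dt A \<Phi> j) \<longrightarrow>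
               (\<forall>u v. dirk_stage \<epsilon> dt A (\<Phi>(i := u)) i \<and> dirk_stage \<epsilon> dt A (\<Phi>(i := v)) i
                  \<longrightarrow> (\<forall>x\<in>cube. u x = v x))))
         \<and> dirk_stable TYPE('d) \<epsilon> dt s A b"
proof -
  have c: "0 \<le> dt * A i i" "dt * A i i \<le> \<epsilon>\<^sup>2" if i: "i \<in> {1..s}" for i
  proof -
    show "0 \<le> dt * A i i" using i diagonal_nonneg \<open>dt > 0\<close> by simp
    define M where "M = Max ((\<lambda>i. A i i) ` {1..s})"
    have le_M: "A j j \<le> M" if "j \<in> {1..s}" for j using that by (simp add: M_def)
    have "M > 0" using diagonal_nonzero diagonal_nonneg le_M by force
    have "dt * A i i \<le> dt * M" using le_M[OF i] \<open>dt > 0\<close> by simp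
    also have "\<dots> \<le> \<epsilon>\<^sup>2" using step_size[folded M_def] \<open>M > 0\<close> by (simp add: field_simps)
    finally show "dt * A i i \<le> \<epsilon>\<^sup>2" .
  qed
  have stage: "u x = v x"
    if "i \<in> {1..s}" "dirk_stage \<epsilon> dt A (\<Phi>(i := u)) i" "dirk_stage \<epsilon> dt A (\<Phi>(i := v)) i" "x \<in> cube"
    for i x and \<Phi> :: "nat \<Rightarrow> real ^ 'd \<Rightarrow> real" and u v
    using dirk_stage_unique[OF \<open>\<epsilon> > 0\<close> c[OF that(1)] _ that(2,3) _ that(4)] that(1) by auto
  moreover have "dirk_stable TYPE('d) \<epsilon> dt s A b"
    unfolding dirk_stable_def
  proof (intro allI impI ballI)
    fix f g h :: "real ^ 'd \<Rightarrow> real" and x :: "real ^ 'd"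
    assume "smooth_on_cube f \<and> neumann f \<and> dirk_step \<epsilon> dt s A b f g \<and> dirk_step \<epsilon> dt s A b f h"
    then have "dirk_step \<epsilon> dt s A b f g" "dirk_step \<epsilon> dt s A b f h" by auto
    then obtain \<Phi> \<Psi> where \<Phi>: "\<Phi> 0 = f" "\<And>i. i \<in> {1..s} \<Longrightarrow> dirk_stage \<epsilon> dt A \<Phi> i"
        "\<And>x. x \<in> cube \<Longrightarrow> g x = \<Phi> 0 x + dt * (\<Sum>i=1..s. b i * allen_cahn_rhs \<epsilon> (\<Phi> i) x)"
      and \<Psi>: "\<Psi> 0 = f" "\<And>i. i \<in> {1..s} \<Longrightarrow> dirk_stage \<epsilon> dt A \<Psi> i"
        "\<And>x. x \<in> cube \<Longrightarrow> h x = \<Psi> 0 x + dt * (\<Sum>i=1..s. b i * allen_cahn_rhs \<epsilon> (\<Psi> i) x)"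
      unfolding dirk_step_def by blast
    have stages: "\<forall>x\<in>cube. \<Phi> i x = \<Psi> i x" if "i \<le> s" for i
      using that
    proof (induction i rule: less_induct)
      case (less i)
      show ?case
      proof (cases "i = 0")
        case True
        then show ?thesis using \<Phi>(1) \<Psi>(1) by simp
      next
        case False
        then have i: "i \<in> {1..s}" "1 \<le> i" using less.prems by auto
        show ?thesis
        proof
          fix y :: "real ^ 'd"
          assume y: "y \<in> cube"
          show "\<Phi> i y = \<Psi> i y"
          proof (rule dirk_stage_unique[OF \<open>\<epsilon> > 0\<close> c[OF i(1)] i(2) \<Phi>(2)[OF i(1)] \<Psi>(2)[OF i(1)] _ y])
            show "\<Phi> j x = \<Psi> j x" if "j < i" "x \<in> cube" for j x
              using less.IH[of j] less.prems that by simp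
          qed
        qed
      qed
    qed
    assume x: "x \<in> cube"
    have "allen_cahn_rhs \<epsilon> (\<Phi> i) x = allen_cahn_rhs \<epsilon> (\<Psi> i) x" if "i \<in> {1..s}" for i
      using stages[of i] that x by (intro allen_cahn_rhs_cong) auto
    then show "g x = h x" using \<Phi>(1,3) \<Psi>(1,3) x by simp
  qed
  ultimately show ?thesis by blast
qed

end
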